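(* For all positive integers $k,n$, it holds that $$s^{(m)}_{k,n} = a^{(m)}_{k,(n-1)k}.$$
   Context: A finite nonempty set $F\subset\mathbb{N}$ is called maximal Schreier if $\min F=|F|$. For $k,n\in\mathbb{N}$, let $s^{(m)}_{k,n}$ be the number of sets $F\subset\{k,2k,\ldots,nk\}$ such that $F$ is maximal Schreier and $nk\in F$. For $k\ge1$, define $(a^{(m)}_{k,n})_{n=0}^\infty$ by: $a^{(m)}_{k,0}=1$ if $k=1$ and $a^{(m)}_{k,0}=0$ if $k>1$; $a^{(m)}_{k,1}=0$; $a^{(m)}_{k,2}=1$; $a^{(m)}_{k,3}=\cdots=a^{(m)}_{k,k+1}=0$ (an empty list when $k=1$); and $a^{(m)}_{k,n}=a^{(m)}_{k,n-k}+a^{(m)}_{k,n-k-1}$ for $n\ge k+1$ (these prescriptions are consistent). *)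

theory Defs
  imports Main
begin

definition maximal_schreier :: "nat set \<Rightarrow> bool" where
  "maximal_schreier F \<longleftrightarrow> finite F \<and> F \<noteq> {} \<and> Min F = card F"

definition s_max :: "nat \<Rightarrow> nat \<Rightarrow> nat" where
  "s_max k n = card {F. F \<subseteq> (\<lambda>i. i * k) ` {1..n} \<and> maximal_schreier F \<and> n * k \<in> F}"

(* The sequence is only meant for k >= 1; the value 0 at k = 0 is a dummy that makes the
   recursion terminate. Initial values take precedence over the recurrence where both
   apply (n = k + 1); a_max_rec below shows that the two agree there. *)
function a_max :: "nat \<Rightarrow> nat \<Rightarrow> nat" where
  "a_max k n =
    (if k = 0 then 0
     else if n = 0 then (if k = 1 then 1 else 0)
     else if n = 1 then 0
     else if n = 2 then 1
     else if n \<le> k + 1 then 0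
     else a_max k (n - k) + a_max k (n - k - 1))"
  by pat_completeness auto
termination by (relation "measure snd") auto

declare a_max.simps [simp del]

lemma a_max_0: "k \<ge> 1 \<Longrightarrow> a_max k 0 = (if k = 1 then 1 else 0)"
  by (simp add: a_max.simps)

lemma a_max_1: "a_max k 1 = 0"
  by (simp add: a_max.simps)

lemma a_max_2: "k \<ge> 1 \<Longrightarrow> a_max k 2 = 1"
  by (simp add: a_max.simps)

lemma a_max_initial: "3 \<le> n \<Longrightarrow> n \<le> k + 1 \<Longrightarrow> a_max k n = 0"
  by (simp add: a_max.simps)

lemma a_max_rec:
  assumes "k \<ge> 1" "n \<ge> k + 1"
  shows "a_max k n = a_max k (n - k) + a_max k (n - k - 1)"
proof (cases "n = k + 1")
  case True
  then show ?thesis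
    using assms(1) a_max_0[of k] a_max_1[of k] a_max_2[of k] a_max_initial[of n k]
    by (cases "k = 1") (auto simp: numeral_2_eq_2)
next
  case False
  then show ?thesis
    using assms by (subst a_max.simps) auto
qed

end

theory Submission
  imports Defs
begin

text \<open>Both sides equal a sum of binomial coefficients. A set counted by \<open>s_max k n\<close>, for
  \<open>n \<ge> 2\<close>, with minimum \<open>j * k\<close> consists of \<open>j * k\<close>, \<open>n * k\<close> and \<open>j * k - 2\<close> of the
  \<open>n - 1 - j\<close> multiples of \<open>k\<close> in between. On the other side, away from index \<open>0\<close> the
  generating function of \<open>a_max k\<close> is \<open>x\<^sup>2 / (1 - x\<^sup>k (1 + x))\<close>, and expanding the geometric
  series gives the coefficients \<open>i choose (m - 2 - k * i)\<close>. The two sums correspond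
  under \<open>i = n - 1 - j\<close>.\<close>

text \<open>Induction along the recurrence, with Pascal's rule matching it term by term. The cutoff
  \<open>L\<close> only has to include every \<open>i\<close> with \<open>k * i + 2 \<le> m\<close>;
  leaving it free lets both recursive calls use \<open>L - 1\<close>. Index 0 is excluded because
  \<open>a_max 1 0 = 1\<close>, while the sum there is 0.\<close>

lemma a_max_eq_sum:
  assumes "k \<ge> 1" "m \<ge> 1" "m < k * L + 2"
  shows "a_max k m = (\<Sum>i<L. if k * i + 2 \<le> m then i choose (m - 2 - k * i) else 0)"
  using assms(2,3)
proof (induction m arbitrary: L rule: less_induct)
  case (less m)
  define t where "t m i = (if k * i + 2 \<le> m then i choose (m - 2 - k * i) else 0)" for m i
  show ?case
  proof (cases L)
    case 0
    then have "m = 1" using less.prems by simp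
    then show ?thesis using 0 a_max_1 by simp
  next
    case (Suc L')
    have split: "(\<Sum>i<L. t m i) = t m 0 + (\<Sum>i<L'. t m (Suc i))"
      unfolding Suc by (rule sum.lessThan_Suc_shift)
    show ?thesis
    \<comment> \<open>For \<open>m \<le> k + 1\<close> only \<open>i = 0\<close> passes the guard,
      and \<open>0 choose (m - 2)\<close> is nonzero only at \<open>m = 2\<close>. Beyond that,
      \<open>m - k - 1 \<ge> 1\<close>, so the recurrence never reaches index 0.\<close>
    proof (cases "m \<le> k + 1")
      case True
      have "t m 0 = (if m = 2 then 1 else 0)"
        using less.prems by (auto simp: t_def binomial_eq_0)
      moreover have "t m (Suc i) = 0" for i
        using True by (simp add: t_def)
      moreover have "a_max k m = (if m = 2 then 1 else 0)"
        using True less.prems assms(1) by (simp add: a_max.simps)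
      ultimately show ?thesis using split by (simp add: t_def)
    next
      case False
      have "t m (Suc i) = t (m - k) i + t (m - k - 1) i" for i
      proof -
        \<comment> \<open>All three terms vanish; or the lower index is 0 and the last term is cut
          off by its guard; or Pascal's rule applies with lower index \<open>d + 1\<close>.\<close>
        consider "m < k * i + k + 2" | "m = k * i + k + 2" | d where "m = k * i + k + 3 + d"
          by (metis less_imp_Suc_add linorder_neqE_nat add_Suc_right add_Suc numeral_3_eq_3 numeral_2_eq_2)
        then show ?thesis
          by cases (auto simp: t_def numeral_3_eq_3)
      qed
      moreover have "t m 0 = 0"
        using False assms(1) by (simp add: t_def)
      moreover have "a_max k (m - k) = (\<Sum>i<L'. t (m - k) i)"
        unfolding t_def by (rule less.IH) (use False less.prems Suc assms(1) in auto)
      moreover have "a_max k (m - k - 1) = (\<Sum>i<L'. t (m - k - 1) i)"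
        unfolding t_def by (rule less.IH) (use False less.prems Suc assms(1) in auto)
      moreover have "a_max k m = a_max k (m - k) + a_max k (m - k - 1)"
        using False assms(1) by (intro a_max_rec) auto
      ultimately show ?thesis
        using split by (simp add: t_def sum.distrib)
    qed
  qed
qed

text \<open>Deleting \<open>a\<close> and \<open>b\<close> is a bijection onto the
  \<open>(c - 2)\<close>-subsets of \<open>B\<close>. The case \<open>c < 2\<close> is separate
  because \<open>c - 2\<close> truncates to 0 there.\<close>

lemma card_subsets_containing_two:
  assumes "finite B" "a \<noteq> b" "a \<notin> B" "b \<notin> B"
  shows "card {F. F \<subseteq> insert a (insert b B) \<and> a \<in> F \<and> b \<in> F \<and> card F = c}
    = (if 2 \<le> c then card B choose (c - 2) else 0)" (is "card ?S = _")
proof (cases "2 \<le> c")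
  case True
  have ab: "card (insert a (insert b G)) = card G + 2" if "G \<subseteq> B" for G
    using assms that finite_subset[OF that] by (auto simp: card_insert_if)
  have "bij_betw (\<lambda>G. insert a (insert b G)) {G. G \<subseteq> B \<and> card G = c - 2} ?S"
  proof (rule bij_betw_byWitness[where f' = "\<lambda>F. F - {a, b}"])
    show "\<forall>G\<in>{G. G \<subseteq> B \<and> card G = c - 2}. insert a (insert b G) - {a, b} = G"
      using assms by auto
    show "\<forall>F\<in>?S. insert a (insert b (F - {a, b})) = F"
      by auto
    show "(\<lambda>G. insert a (insert b G)) ` {G. G \<subseteq> B \<and> card G = c - 2} \<subseteq> ?S"
      using True ab by auto
    show "(\<lambda>F. F - {a, b}) ` ?S \<subseteq> {G. G \<subseteq> B \<and> card G = c - 2}"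
      using assms(2) by (auto simp: card_Diff_subset numeral_2_eq_2)
  qed
  then have "card ?S = card {G. G \<subseteq> B \<and> card G = c - 2}"
    by (simp add: bij_betw_same_card)
  then show ?thesis
    using True n_subsets[OF assms(1)] by simp
next
  case False
  have "2 \<le> card F" if "F \<in> ?S" for F
  proof -
    have "finite F" "{a, b} \<subseteq> F"
      using that assms(1) by (auto intro: finite_subset)
    then show ?thesis
      using card_mono[of F "{a, b}"] assms(2) by simp
  qed
  then have "?S = {}"
    using False by blast
  then show ?thesis
    using False by (simp only: card.empty if_False)
qed

lemma s_max_eq_sum:
  assumes "k \<ge> 1" "n \<ge> 2"
  shows "s_max k n = (\<Sum>j\<in>{1..<n}. if 2 \<le> j * k then (n - 1 - j) choose (j * k - 2) else 0)"
proof -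
  let ?U = "(\<lambda>i. i * k) ` {1..n}"
  define B where "B j = (\<lambda>i. i * k) ` {j<..<n}" for j
  define S where "S j = {F. F \<subseteq> insert (j * k) (insert (n * k) (B j)) \<and>
    j * k \<in> F \<and> n * k \<in> F \<and> card F = j * k}" for j
  \<comment> \<open>The ground set of \<open>S j\<close> has no element below \<open>j * k\<close>,
    so containing \<open>j * k\<close> fixes the minimum.\<close>
  have U: "insert (j * k) (insert (n * k) (B j)) = {x \<in> ?U. j * k \<le> x}" if "j \<in> {1..<n}" for j
    using that assms by (auto simp: B_def image_iff)
  have Min_S: "F \<noteq> {}" "finite F" "Min F = j * k" if "j \<in> {1..<n}" "F \<in> S j" for j F
  proof -
    have *: "F \<subseteq> {x \<in> ?U. j * k \<le> x}" "j * k \<in> F"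
      using that U[OF that(1)] by (auto simp: S_def)
    then show "F \<noteq> {}" "finite F"
      by (auto intro: finite_subset)
    then show "Min F = j * k"
      using * by (intro Min_eqI) auto
  qed
  have "{F. F \<subseteq> ?U \<and> maximal_schreier F \<and> n * k \<in> F} = (\<Union>j\<in>{1..<n}. S j)"
  proof (intro subset_antisym subsetI)
    fix F assume "F \<in> {F. F \<subseteq> ?U \<and> maximal_schreier F \<and> n * k \<in> F}"
    then have F: "F \<subseteq> ?U" "finite F" "F \<noteq> {}" "Min F = card F" "n * k \<in> F"
      by (auto simp: maximal_schreier_def)
    then obtain j where j: "j \<in> {1..n}" "Min F = j * k"
      by (metis (no_types, lifting) Min_in imageE subsetD)
    \<comment> \<open>A set with minimum \<open>n * k\<close> would be a singleton, but its
      cardinality would have to be \<open>n * k \<ge> 2\<close>.\<close>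
    have "j \<noteq> n"
    proof
      assume "j = n"
      have "F \<subseteq> {n * k}"
      proof
        fix x assume x: "x \<in> F"
        then have "n * k \<le> x"
          using F(2) j(2) \<open>j = n\<close> Min_le by metis
        moreover have "x \<le> n * k"
          using x F(1) by auto
        ultimately show "x \<in> {n * k}" by simp
      qed
      then have "card F \<le> 1"
        using card_mono[of "{n * k}" F] by simp
      moreover have "n * k \<ge> 2 * 1"
        using assms by (intro mult_le_mono)
      ultimately show False
        using F(4) j(2) \<open>j = n\<close> by simp
    qed
    then have jn: "j \<in> {1..<n}" using j by auto
    have "F \<subseteq> {x \<in> ?U. j * k \<le> x}"
      using F(1) Min_le[OF F(2)] j(2) by auto
    moreover have "j * k \<in> F"
      using Min_in[OF F(2,3)] j(2) by simp
    ultimately have "F \<in> S j"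
      using F(4,5) j(2) U[OF jn] by (simp add: S_def)
    then show "F \<in> (\<Union>j\<in>{1..<n}. S j)"
      using jn by blast
  next
    fix F assume "F \<in> (\<Union>j\<in>{1..<n}. S j)"
    then obtain j where j: "j \<in> {1..<n}" "F \<in> S j" by blast
    then have "F \<subseteq> ?U" "n * k \<in> F" "card F = j * k"
      using U[OF j(1)] by (auto simp: S_def)
    then show "F \<in> {F. F \<subseteq> ?U \<and> maximal_schreier F \<and> n * k \<in> F}"
      using Min_S[OF j] by (simp add: maximal_schreier_def)
  qed
  then have "s_max k n = card (\<Union>j\<in>{1..<n}. S j)"
    by (simp add: s_max_def)
  also have "\<dots> = (\<Sum>j\<in>{1..<n}. card (S j))"
  proof (rule card_UN_disjoint)
    show "\<forall>j\<in>{1..<n}. finite (S j)"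
      by (auto simp: S_def B_def)
    \<comment> \<open>The minimum \<open>j * k\<close> of a member determines \<open>j\<close>, as
      \<open>k\<close> is positive.\<close>
    show "\<forall>i\<in>{1..<n}. \<forall>j\<in>{1..<n}. i \<noteq> j \<longrightarrow> S i \<inter> S j = {}"
    proof (intro ballI impI)
      fix i j assume ij: "i \<in> {1..<n}" "j \<in> {1..<n}" "i \<noteq> j"
      have False if "F \<in> S i" "F \<in> S j" for F
        using Min_S(3)[OF ij(1) that(1)] Min_S(3)[OF ij(2) that(2)] ij(3) assms(1) by simp
      then show "S i \<inter> S j = {}" by blast
    qed
  qed simp
  also have "\<dots> = (\<Sum>j\<in>{1..<n}. if 2 \<le> j * k then (n - 1 - j) choose (j * k - 2) else 0)"
  proof (rule sum.cong[OF refl])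
    fix j assume j: "j \<in> {1..<n}"
    have "card (B j) = n - 1 - j"
      using assms(1) by (simp add: B_def card_image inj_on_def)
    moreover have "card (S j) = (if 2 \<le> j * k then card (B j) choose (j * k - 2) else 0)"
      unfolding S_def
      by (rule card_subsets_containing_two) (use j assms(1) in \<open>auto simp: B_def\<close>)
    ultimately show "card (S j) = (if 2 \<le> j * k then (n - 1 - j) choose (j * k - 2) else 0)"
      by simp
  qed
  finally show ?thesis .
qed

text \<open>The only candidate is \<open>{k}\<close>, whose minimum is \<open>k\<close> and
  cardinality 1. Here minimum and maximum coincide, so the count by two distinct endpoints does not
  cover this case.\<close>

lemma s_max_1:
  assumes "k \<ge> 1"
  shows "s_max k 1 = (if k = 1 then 1 else 0)"
proof -
  have "{F. F \<subseteq> (\<lambda>i. i * k) ` {1..1} \<and> maximal_schreier F \<and> 1 * k \<in> F}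
    = (if k = 1 then {{k}} else {})"
    by (auto simp: maximal_schreier_def subset_singleton_iff)
  then show ?thesis
    by (simp add: s_max_def)
qed

theorem theorem1p2:
  fixes k n :: nat
  assumes "k \<ge> 1" and "n \<ge> 1"
  shows "s_max k n = a_max k ((n - 1) * k)"
proof (cases "n = 1")
  case True
  then show ?thesis
    using s_max_1 a_max_0 assms(1) by simp
next
  case False
  then have n: "n \<ge> 2" using assms(2) by simp
  have "a_max k ((n - 1) * k) = (\<Sum>i<n - 1. if k * i + 2 \<le> (n - 1) * k
      then i choose ((n - 1) * k - 2 - k * i) else 0)"
    using assms(1) n by (intro a_max_eq_sum) auto
  also have "\<dots> = (\<Sum>j\<in>{1..<n}. if 2 \<le> j * k then (n - 1 - j) choose (j * k - 2) else 0)"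
  proof (rule sum.reindex_bij_witness[where i = "\<lambda>j. n - 1 - j" and j = "\<lambda>i. n - 1 - i"])
    fix i assume "i \<in> {..<n - 1}"
    \<comment> \<open>Writing \<open>n - 1 = i + j\<close> removes the truncated subtractions: both
      guards become \<open>2 \<le> j * k\<close> and both lower indices
      \<open>j * k - 2\<close>.\<close>
    then obtain j where j: "n - 1 = i + j"
      by (metis lessThan_iff less_imp_add_positive)
    show "(if 2 \<le> (n - 1 - i) * k then (n - 1 - (n - 1 - i)) choose ((n - 1 - i) * k - 2) else 0)
      = (if k * i + 2 \<le> (n - 1) * k then i choose ((n - 1) * k - 2 - k * i) else 0)"
      unfolding j by (simp add: algebra_simps)
  qed auto
  also have "\<dots> = s_max k n"
    using s_max_eq_sum[OF assms(1) n] by simp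
  finally show ?thesis by simp
qed

end
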